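(* Let $n\ge 1$, let $\mathcal{I}\subset\{1,\dots,n\}\times\{1,\dots,n\}$ with complement $\bar{\mathcal{I}}$, let real numbers $\sigma_{ij}$, $(i,j)\in\bar{\mathcal{I}}$, be given, and let $\Sigma(x)\in\mathbb{R}^{n\times n}$, $x=(x_{ij})_{(i,j)\in\mathcal{I}}\in\mathbb{R}^{k}$, $k=|\mathcal{I}|$, be the associated partial matrix. Let $\bar{x}\in\mathbb{R}^k$. Then the following are equivalent: (1) $\Sigma(\bar{x})$ is nonsingular and $[\Sigma(\bar{x})^{-1}]_{i,j}=0$ for all $(i,j)\in\mathcal{I}^{\top}$; (2) $\Sigma(\bar{x})$ is nonsingular and extremizes $\det[\Sigma(x)]$ among completions, i.e. $\bar{x}$ is a critical point of the function $x\mapsto\det[\Sigma(x)]$ on $\mathbb{R}^k$.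
   Context: The partial matrix $\Sigma(x)$ is the parametric family of real $n\times n$ matrices with entries $[\Sigma(x)]_{i,j}=\sigma_{ij}$ (specified) for $(i,j)\in\bar{\mathcal{I}}$ and $[\Sigma(x)]_{i,j}=x_{ij}$ (free real unknowns) for $(i,j)\in\mathcal{I}$; $x\in\mathbb{R}^k$ is the vector obtained by stacking the unknowns $x_{ij}$. A completion is a matrix $\Sigma(\bar{x})$ with $\bar{x}\in\mathbb{R}^k$; no symmetry, positivity or other structure is required. $\mathcal{I}^{\top}:=\{(j,i):(i,j)\in\mathcal{I}\}$. "Extremize" means being a critical (stationary) point: all partial derivatives with respect to the unknowns $x_{ij}$, $(i,j)\in\mathcal{I}$, vanish at $\bar{x}$. *)

theory Defs
  imports "HOL-Analysis.Analysis"
begin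

text \<open>
  The index set \<open>{1,\<dots>,n}\<close> is a finite type. A point of \<open>\<real>\<^sup>k\<close>, \<open>k = card I\<close>, is represented by
  a function on index pairs of which only the values on \<open>I\<close> matter; likewise only the values of
  \<open>\<sigma>\<close> off \<open>I\<close> matter.
\<close>

definition partial_matrix ::
    "('n::finite \<times> 'n) set \<Rightarrow> ('n \<times> 'n \<Rightarrow> real) \<Rightarrow> ('n \<times> 'n \<Rightarrow> real) \<Rightarrow> real^'n^'n" where
  "partial_matrix I \<sigma> x = (\<chi> i j. if (i, j) \<in> I then x (i, j) else \<sigma> (i, j))"

text \<open>All partial derivatives along the coordinates in \<open>K\<close> exist and vanish at \<open>x\<close>.\<close>

definition critical_point :: "'k set \<Rightarrow> (('k \<Rightarrow> real) \<Rightarrow> real) \<Rightarrow> ('k \<Rightarrow> real) \<Rightarrow> bool" where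
  "critical_point K f x \<longleftrightarrow>
    (\<forall>p\<in>K. ((\<lambda>t. f (x(p := t))) has_real_derivative 0) (at (x p)))"

end

theory Submission
  imports Defs
begin

text \<open>
  Changing the single entry \<open>(i, j)\<close> of an invertible \<open>A\<close> by \<open>h\<close> adds \<open>h *\<^sub>R e\<^sub>i\<close> to column \<open>j\<close>, and
  \<open>e\<^sub>i = A (A\<inverse> e\<^sub>i)\<close>. The new column is thus \<open>A (e\<^sub>j + h *\<^sub>R A\<inverse> e\<^sub>i)\<close>, so Cramer's rule
  (\<open>cramer_lemma\<close>) multiplies the determinant by the \<open>j\<close>-th component
  \<open>1 + h * (A\<inverse>)\<^sub>j\<^sub>i\<close>. The determinant is therefore affine in each unknown \<open>x\<^sub>i\<^sub>j\<close>, with partial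
  derivative \<open>det A * (A\<inverse>)\<^sub>j\<^sub>i\<close>. As \<open>det A \<noteq> 0\<close>, this vanishes exactly when the entry of the
  inverse at the transposed position does.
\<close>

lemma matrix_mul_matrix_inv:
  fixes A :: "'a::semiring_1^'n^'m"
  assumes "invertible A"
  shows "A ** matrix_inv A = mat 1"
  using someI_ex[OF assms[unfolded invertible_def]] by (simp add: matrix_inv_def)

lemma det_update_entry:
  fixes A :: "real^'n^'n"
  assumes "invertible A"
  shows "det (\<chi> k l. if k = i \<and> l = j then t else A $ k $ l) =
    (1 + (t - A $ i $ j) * matrix_inv A $ j $ i) * det A"
proof -
  define x where "x = axis j 1 + (t - A $ i $ j) *\<^sub>R (matrix_inv A *v axis i 1)"
  have "A *v (matrix_inv A *v axis i 1) = axis i 1"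
    using matrix_mul_matrix_inv[OF assms] by (simp add: matrix_vector_mul_assoc)
  then have Ax: "A *v x = column j A + (t - A $ i $ j) *\<^sub>R axis i 1"
    by (simp add: x_def matrix_vector_right_distrib matrix_vector_mult_scaleR
        matrix_vector_mult_basis)
  have "(\<chi> k l. if k = i \<and> l = j then t else A $ k $ l) =
      (\<chi> k l. if l = j then (A *v x) $ k else A $ k $ l)"
    unfolding Ax by (auto simp: vec_eq_iff column_def axis_def)
  moreover have "x $ j = 1 + (t - A $ i $ j) * matrix_inv A $ j $ i"
    by (simp add: x_def matrix_vector_mult_basis column_def)
  ultimately show ?thesis
    by (simp add: cramer_lemma)
qed

lemma partial_derivative_det_partial_matrix:
  fixes I :: "('n::finite \<times> 'n) set"
  assumes inv: "invertible (partial_matrix I \<sigma> x)" and I: "(i, j) \<in> I"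
  shows "((\<lambda>t. det (partial_matrix I \<sigma> (x((i, j) := t)))) has_real_derivative
    matrix_inv (partial_matrix I \<sigma> x) $ j $ i * det (partial_matrix I \<sigma> x)) (at (x (i, j)))"
proof -
  let ?A = "partial_matrix I \<sigma> x"
  have upd: "partial_matrix I \<sigma> (x((i, j) := t)) =
      (\<chi> k l. if k = i \<and> l = j then t else ?A $ k $ l)" for t
    using I by (auto simp: partial_matrix_def vec_eq_iff)
  show ?thesis
    unfolding upd det_update_entry[OF inv]
    by (auto intro!: derivative_eq_intros)
qed

theorem mainTheorem1:
  fixes I :: "('n::finite \<times> 'n) set"
    and \<sigma> :: "'n \<times> 'n \<Rightarrow> real"
    and xbar :: "'n \<times> 'n \<Rightarrow> real"
  shows "(invertible (partial_matrix I \<sigma> xbar) \<and>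
          (\<forall>(i, j)\<in>I\<inverse>. matrix_inv (partial_matrix I \<sigma> xbar) $ i $ j = 0))
     \<longleftrightarrow> (invertible (partial_matrix I \<sigma> xbar) \<and>
          critical_point I (\<lambda>x. det (partial_matrix I \<sigma> x)) xbar)"
proof (rule conj_cong[OF refl])
  let ?A = "partial_matrix I \<sigma> xbar"
  assume inv: "invertible ?A"
  then have det: "det ?A \<noteq> 0"
    by (simp add: invertible_det_nz)
  have "((\<lambda>t. det (partial_matrix I \<sigma> (xbar((i, j) := t)))) has_real_derivative 0)
      (at (xbar (i, j))) \<longleftrightarrow> matrix_inv ?A $ j $ i = 0" if "(i, j) \<in> I" for i j
    using partial_derivative_det_partial_matrix[OF inv that] det
    by (metis DERIV_unique mult_eq_0_iff)
  then show "(\<forall>(i, j)\<in>I\<inverse>. matrix_inv ?A $ i $ j = 0) \<longleftrightarrow>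
      critical_point I (\<lambda>x. det (partial_matrix I \<sigma> x)) xbar"
    unfolding critical_point_def by fastforce
qed

end
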